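(* Let $n\ge 3$, let $e$ be an edge of the complete graph $K_n$, and let $\phi$ be a symmetric real function with $\phi(x,y)>0$ on all degree pairs that occur on edges of $K_n$ and $K_n-e$. Put $b_n=\phi(n-1,n-1)>0$, $a_n=\phi(n-2,n-1)>0$, $R_n=\frac{b_n}{a_n}$ and $\tau_n=\sqrt{\frac{n-2}{n-1}}$. Then $$\dot E_\phi(K_n-e)-\dot E_\phi(K_n)=2\Big(\rho(\dot A(K_n-e))-\rho(\dot A(K_n))\Big).$$ More precisely: (1) if $R_n<\tau_n$, then both the spectral radius and the energy strictly increase after deleting $e$, i.e. $\rho(\dot A(K_n-e))>\rho(\dot A(K_n))$ and $\dot E_\phi(K_n-e)>\dot E_\phi(K_n)$; (2) if $R_n=\tau_n$, then both quantities remain unchanged; (3) if $R_n>\tau_n$, then both the spectral radius and the energy strictly decrease after deleting $e$.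
   Context: For a symmetric function $\phi:\mathbb R_{>0}\times\mathbb R_{>0}\to\mathbb R$ and a finite simple graph $G$ with vertices $v_1,\dots,v_n$ of degrees $d_1,\dots,d_n$, the degree-based weighted adjacency matrix $\dot A(G)$ is the $n\times n$ real symmetric matrix whose $(i,j)$ entry is $\phi(d_i,d_j)$ if $v_i$ and $v_j$ are adjacent, and $0$ otherwise. $\rho(M)$ is the spectral radius, and the weighted energy $\dot E_\phi(G)$ is the sum of the absolute values of the eigenvalues of $\dot A(G)$. $G-e$ is the graph obtained by deleting the edge $e$ (keeping all vertices); $\dot A(G-e)$ is computed with the degrees of $G-e$. *)

theory Defs
  imports "Jordan_Normal_Form.Spectral_Radius"
begin

text \<open>
  A simple graph on the vertices \<open>0, \<dots>, n - 1\<close> is given by \<open>n\<close> and its set of edges, each edge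
  being a two-element set of vertices.
\<close>

definition simple_graph :: "nat \<Rightarrow> nat set set \<Rightarrow> bool" where
  "simple_graph n E \<longleftrightarrow> (\<forall>e\<in>E. e \<subseteq> {..<n} \<and> card e = 2)"

definition vdegree :: "nat set set \<Rightarrow> nat \<Rightarrow> nat" where
  "vdegree E v = card {e \<in> E. v \<in> e}"

definition complete_edges :: "nat \<Rightarrow> nat set set" where
  "complete_edges n = {e. e \<subseteq> {..<n} \<and> card e = 2}"

lemma simple_graph_complete: "simple_graph n (complete_edges n)"
  by (simp add: simple_graph_def complete_edges_def)

lemma simple_graph_delete: "simple_graph n E \<Longrightarrow> simple_graph n (E - {e})"
  by (simp add: simple_graph_def)

definition weighted_adj_mat :: "(real \<Rightarrow> real \<Rightarrow> real) \<Rightarrow> nat \<Rightarrow> nat set set \<Rightarrow> real mat" where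
  "weighted_adj_mat \<phi> n E =
    mat n n (\<lambda>(i, j). if {i, j} \<in> E then \<phi> (real (vdegree E i)) (real (vdegree E j)) else 0)"

text \<open>
  Eigenvalues of a real matrix are taken over the complex numbers (for a symmetric matrix they are
  all real); the multiset \<open>proots\<close> of roots of the characteristic polynomial counts them with
  algebraic multiplicity.
\<close>

definition weighted_spectral_radius :: "(real \<Rightarrow> real \<Rightarrow> real) \<Rightarrow> nat \<Rightarrow> nat set set \<Rightarrow> real" where
  "weighted_spectral_radius \<phi> n E =
    spectral_radius (map_mat complex_of_real (weighted_adj_mat \<phi> n E))"

definition weighted_energy :: "(real \<Rightarrow> real \<Rightarrow> real) \<Rightarrow> nat \<Rightarrow> nat set set \<Rightarrow> real" where
  "weighted_energy \<phi> n E =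
    (\<Sum>x\<in># proots (char_poly (map_mat complex_of_real (weighted_adj_mat \<phi> n E))). cmod x)"

text \<open>
  Symmetry is only required on positive arguments, the domain of the weight function; its values
  elsewhere play no role.
\<close>

definition symmetric_weight :: "(real \<Rightarrow> real \<Rightarrow> real) \<Rightarrow> bool" where
  "symmetric_weight \<phi> \<longleftrightarrow> (\<forall>x>0. \<forall>y>0. \<phi> x y = \<phi> y x)"

definition positive_on_edges :: "(real \<Rightarrow> real \<Rightarrow> real) \<Rightarrow> nat set set \<Rightarrow> bool" where
  "positive_on_edges \<phi> E \<longleftrightarrow>
    (\<forall>u v. {u, v} \<in> E \<longrightarrow> \<phi> (real (vdegree E u)) (real (vdegree E v)) > 0)"

end

theory Submission
  imports Defs
begin

text \<open>
  Both adjacency matrices are block matrices up to a multiple of the identity: cut the vertices into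
  \<open>m\<close> cells so that every entry off the diagonal depends only on the cells of its two indices. For
  \<open>K\<^sub>n\<close> one cell is enough; for \<open>K\<^sub>n - {u, v}\<close> the cells are \<open>{u}\<close>, \<open>{v}\<close> and the rest. Adding
  \<open>b\<close> times the identity puts the right constant on the diagonal too, so the matrix is \<open>U V - b I\<close>
  with \<open>U\<close> having only \<open>m\<close> columns. Exchanging the two factors (Sylvester's determinant identity,
  \<open>power_mult_det_shift_prod_commute\<close>) leaves an \<open>m \<times> m\<close> determinant, and \<open>-b\<close> is an eigenvalue with
  the missing multiplicity \<open>n - m\<close>. The characteristic polynomials are therefore
  \<open>(x + b) ^ (n - 1) * (x - (n - 1) * b)\<close> for \<open>K\<^sub>n\<close> and
  \<open>(x + b) ^ (n - 3) * x * (x\<^sup>2 - (n - 3) * b * x - 2 * (n - 2) * a\<^sup>2)\<close> for \<open>K\<^sub>n - {u, v}\<close>.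

  Each of these polynomials has exactly one positive root \<open>l\<close>, and the trace of the matrix vanishes.
  Hence the other eigenvalues have absolute values adding up to \<open>l\<close>: the spectral radius is \<open>l\<close> and
  the energy is \<open>2 * l\<close> (\<open>one_positive_eigenvalue\<close>). This gives the identity between the two
  differences, and only the positive roots are left to compare. The number \<open>(n - 1) * b\<close> exceeds the
  positive root of the quadratic factor exactly if the factor is positive there; its value is
  \<open>2 * ((n - 1) * b\<^sup>2 - (n - 2) * a\<^sup>2)\<close>, whose sign is that of \<open>b / a - sqrt ((n - 2) / (n - 1))\<close>
  (\<open>positive_root_vs_complete\<close>).
\<close>

section \<open>Determinants of matrices that are constant on cells\<close>

text \<open>
  Sylvester's determinant identity. Both sides are \<open>y ^ m\<close> times the determinant of the matrix with
  blocks \<open>y I\<close>, \<open>U\<close>, \<open>V\<close>, \<open>I\<close>, whose lower left block can be cleared in two ways. Column operations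
  use the block \<open>I\<close> as pivot and leave \<open>y I - U V\<close> and \<open>I\<close> on the diagonal. Row operations use
  \<open>y I\<close> as pivot; to avoid division, the lower block row is scaled by \<open>y\<close> first, which gives the
  factor \<open>y ^ m\<close>, and \<open>y I\<close> and \<open>y I - V U\<close> are left on the diagonal.
\<close>

lemma power_mult_det_shift_prod_commute:
  fixes U V :: "'a :: idom mat"
  assumes U: "U \<in> carrier_mat n m" and V: "V \<in> carrier_mat m n"
  shows "y ^ m * det (y \<cdot>\<^sub>m 1\<^sub>m n - U * V) = y ^ n * det (y \<cdot>\<^sub>m 1\<^sub>m m - V * U)"
proof -
  let ?M = "four_block_mat (y \<cdot>\<^sub>m 1\<^sub>m n) U V (1\<^sub>m m)"
  let ?P = "four_block_mat (1\<^sub>m n) (0\<^sub>m n m) (- V) (1\<^sub>m m)"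
  let ?Q = "four_block_mat (1\<^sub>m n) (0\<^sub>m n m) (- V) (y \<cdot>\<^sub>m 1\<^sub>m m)"
  have M: "?M \<in> carrier_mat (n + m) (n + m)" by simp
  have MP: "?M * ?P = four_block_mat (y \<cdot>\<^sub>m 1\<^sub>m n - U * V) U (0\<^sub>m m n) (1\<^sub>m m)"
    using U V
    by (subst mult_four_block_mat[of _ n n _ m _ m _ _ n _ m])
      (auto intro!: cong_four_block_mat eq_matI)
  have QM: "?Q * ?M = four_block_mat (y \<cdot>\<^sub>m 1\<^sub>m n) U (0\<^sub>m m n) (y \<cdot>\<^sub>m 1\<^sub>m m - V * U)"
    using U V
    by (subst mult_four_block_mat[of _ n n _ m _ m _ _ n _ m])
      (auto intro!: cong_four_block_mat eq_matI)
  have "det ?M * det ?P = det (y \<cdot>\<^sub>m 1\<^sub>m n - U * V)"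
    unfolding det_mult[OF M, of ?P, simplified, symmetric] MP
    using U V by (subst det_four_block_mat_lower_left_zero[of _ n _ m]) auto
  moreover have "det ?P = 1"
    using V by (subst det_four_block_mat_upper_right_zero[of _ n _ m]) auto
  moreover have "det ?Q * det ?M = y ^ n * det (y \<cdot>\<^sub>m 1\<^sub>m m - V * U)"
    unfolding det_mult[OF _ M, of ?Q, simplified, symmetric] QM
    using U V by (subst det_four_block_mat_lower_left_zero[of _ n _ m]) auto
  moreover have "det ?Q = y ^ m"
    using V by (subst det_four_block_mat_upper_right_zero[of _ n _ m]) auto
  ultimately show ?thesis by (metis mult.right_neutral)
qed

text \<open>
  The matrix with entries \<open>C (f i) (f j)\<close> factors through the \<open>m\<close> cells of \<open>f\<close>: let \<open>U\<close> be the
  incidence matrix of vertices and cells, and let \<open>V\<close> hold the rows of \<open>C\<close> spread over the vertices.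
  In the product \<open>V U\<close> each column is multiplied by the size of its cell, which is the quotient matrix
  of the equitable partition.
\<close>

lemma det_shift_equitable_quotient:
  fixes C :: "nat \<Rightarrow> nat \<Rightarrow> 'a :: idom"
  assumes f: "\<And>i. i < n \<Longrightarrow> f i < m"
  shows "y ^ m * det (mat n n (\<lambda>(i, j). (if i = j then y else 0) - C (f i) (f j))) =
    y ^ n * det (mat m m (\<lambda>(k, l). (if k = l then y else 0) - of_nat (card {i. i < n \<and> f i = l}) * C k l))"
proof -
  define U :: "'a mat" where "U = mat n m (\<lambda>(i, k). of_bool (f i = k))"
  define V where "V = mat m n (\<lambda>(k, j). C k (f j))"
  have UV: "mat n n (\<lambda>(i, j). (if i = j then y else 0) - C (f i) (f j)) = y \<cdot>\<^sub>m 1\<^sub>m n - U * V"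
  proof (rule eq_matI)
    fix i j assume "i < dim_row (y \<cdot>\<^sub>m 1\<^sub>m n - U * V)" "j < dim_col (y \<cdot>\<^sub>m 1\<^sub>m n - U * V)"
    then have ij: "i < n" "j < n" by (auto simp: U_def V_def)
    have "(U * V) $$ (i, j) = (\<Sum>k = 0..<m. of_bool (f i = k) * C k (f j))"
      using ij by (auto simp: U_def V_def scalar_prod_def intro!: sum.cong)
    also have "\<dots> = C (f i) (f j)"
      using f[OF ij(1)] by (simp add: of_bool_def if_distrib[of "\<lambda>x. x * _"] sum.delta cong: if_cong)
    finally show "mat n n (\<lambda>(i, j). (if i = j then y else 0) - C (f i) (f j)) $$ (i, j) =
        (y \<cdot>\<^sub>m 1\<^sub>m n - U * V) $$ (i, j)"
      using ij by (simp add: U_def V_def del: index_mult_mat(1))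
  qed (auto simp: U_def V_def)
  have VU: "mat m m (\<lambda>(k, l). (if k = l then y else 0) - of_nat (card {i. i < n \<and> f i = l}) * C k l)
      = y \<cdot>\<^sub>m 1\<^sub>m m - V * U"
  proof (rule eq_matI)
    fix k l assume "k < dim_row (y \<cdot>\<^sub>m 1\<^sub>m m - V * U)" "l < dim_col (y \<cdot>\<^sub>m 1\<^sub>m m - V * U)"
    then have kl: "k < m" "l < m" by (auto simp: U_def V_def)
    have "(V * U) $$ (k, l) = (\<Sum>j = 0..<n. C k (f j) * of_bool (f j = l))"
      using kl by (auto simp: U_def V_def scalar_prod_def intro!: sum.cong)
    also have "\<dots> = (\<Sum>j \<in> {i. i < n \<and> f i = l}. C k l)"
      by (rule sum.mono_neutral_cong_right) auto
    finally show "mat m m (\<lambda>(k, l). (if k = l then y else 0) - of_nat (card {i. i < n \<and> f i = l}) * C k l) $$ (k, l) =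
        (y \<cdot>\<^sub>m 1\<^sub>m m - V * U) $$ (k, l)"
      using kl by (simp add: U_def V_def del: index_mult_mat(1))
  qed (auto simp: U_def V_def)
  show ?thesis unfolding UV VU
    by (rule power_mult_det_shift_prod_commute) (auto simp: U_def V_def)
qed

lemma det_mat_3:
  "det (mat 3 3 f :: 'a :: comm_ring_1 mat) =
     f (0,0) * (f (1,1) * f (2,2) - f (1,2) * f (2,1))
   - f (1,0) * (f (0,1) * f (2,2) - f (0,2) * f (2,1))
   + f (2,0) * (f (0,1) * f (1,2) - f (0,2) * f (1,1))"
proof -
  have 2: "det (mat 2 2 g) = g (0,0) * g (1,1) - g (0,1) * g (1,0)" for g :: "_ \<Rightarrow> 'a"
    by (subst laplace_expansion_column[of _ 2 0])
      (auto simp: lessThan_Suc numeral_2_eq_2 cofactor_def mat_delete_def det_single)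
  show ?thesis
    by (subst laplace_expansion_column[of _ 3 0])
      (auto simp: lessThan_Suc numeral_3_eq_3 cofactor_def mat_delete_def 2[unfolded numeral_2_eq_2] numeral_2_eq_2 algebra_simps)
qed

text \<open>
  The parameter \<open>q\<close> is the characteristic polynomial of the quotient matrix, shifted by \<open>b\<close>. It is
  described by its values, so that a quotient of explicit small size can be computed over the reals
  rather than over polynomials.
\<close>

lemma char_poly_equitable_quotient:
  fixes C :: "nat \<Rightarrow> nat \<Rightarrow> real"
  assumes f: "\<And>i. i < n \<Longrightarrow> f i < m"
    and A: "A = mat n n (\<lambda>(i, j). C (f i) (f j) - (if i = j then b else 0))"
    and q: "\<And>x. det (mat m m (\<lambda>(k, l). (if k = l then x + b else 0)
              - of_nat (card {i. i < n \<and> f i = l}) * C k l)) = poly q x"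
    and "m \<le> n"
  shows "char_poly A = [:b, 1:] ^ (n - m) * q"
proof -
  \<comment> \<open>The factor \<open>(x + b) ^ m\<close> cannot be cancelled at \<open>x = - b\<close>, but it can as a polynomial.\<close>
  have "poly ([:b, 1:] ^ m * char_poly A) x = poly ([:b, 1:] ^ m * ([:b, 1:] ^ (n - m) * q)) x" for x
  proof -
    have "- char_matrix A x = mat n n (\<lambda>(i, j). (if i = j then x + b else 0) - C (f i) (f j))"
      by (rule eq_matI) (auto simp: A char_matrix_def)
    then have "poly (char_poly A) x = det (mat n n (\<lambda>(i, j). (if i = j then x + b else 0) - C (f i) (f j)))"
      using char_poly_matrix[of A n x] by (simp add: A)
    moreover have "(x + b) ^ n = (x + b) ^ m * (x + b) ^ (n - m)"
      using \<open>m \<le> n\<close> by (simp flip: power_add)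
    ultimately show ?thesis
      using det_shift_equitable_quotient[of n f m "x + b" C] f q[of x] by (simp add: add.commute mult.assoc)
  qed
  then have "[:b, 1:] ^ m * char_poly A = [:b, 1:] ^ m * ([:b, 1:] ^ (n - m) * q)"
    by (metis poly_eq_poly_eq_iff ext)
  then show ?thesis by simp
qed

section \<open>Matrices of trace zero with one positive eigenvalue\<close>

text \<open>
  With \<open>l\<close> balancing the eigenvalues in \<open>N\<close>, the absolute values over \<open>N\<close> add up to \<open>l\<close>. So none
  of them exceeds \<open>l\<close>, and the full sum is \<open>2 * l\<close>.
\<close>

lemma one_positive_eigenvalue:
  fixes A :: "real mat" and l :: real and N :: "real multiset"
  assumes A: "A \<in> carrier_mat n n"
    and split: "char_poly A = (\<Prod>r\<in>#add_mset l N. [:- r, 1:])"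
    and N: "\<And>r. r \<in># N \<Longrightarrow> r \<le> 0" and trace: "l = - \<Sum>\<^sub># N"
  shows "spectral_radius (map_mat complex_of_real A) = l"
    and "(\<Sum>x\<in>#proots (char_poly (map_mat complex_of_real A)). cmod x) = 2 * l"
proof -
  let ?A = "map_mat complex_of_real A"
  let ?R = "add_mset l N"
  have cp: "char_poly ?A = (\<Prod>r\<in>#?R. [:- complex_of_real r, 1:])"
  proof -
    interpret hom: map_poly_comm_ring_hom complex_of_real ..
    have "map_poly complex_of_real (\<Prod>r\<in>#M. [:- r, 1:]) = (\<Prod>r\<in>#M. [:- complex_of_real r, 1:])" for M
    proof (induction M)
      case (add r M)
      then show ?case by (simp add: hom.hom_mult del: mult_pCons_left)
    qed simp
    then show ?thesis
      using of_real_hom.char_poly_hom[OF A, where ?'a = complex] split by metis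
  qed
  have roots: "proots (char_poly ?A) = image_mset complex_of_real ?R"
  proof -
    have "proots (\<Prod>r\<in>#M. [:- complex_of_real r, 1:]) = image_mset complex_of_real M \<and>
          (\<Prod>r\<in>#M. [:- complex_of_real r, 1:]) \<noteq> 0" for M
      by (induction M) (auto simp: proots_mult simp del: mult_pCons_left)
    then show ?thesis unfolding cp by blast
  qed
  have abs_N: "(\<Sum>r\<in>#N. \<bar>r\<bar>) = l"
  proof -
    have "(\<Sum>r\<in>#N. \<bar>r\<bar>) = (\<Sum>r\<in>#N. - r)"
      using N by (intro arg_cong[where f = sum_mset] image_mset_cong) auto
    also have "\<dots> = - \<Sum>\<^sub># N" by (induction N) auto
    finally show ?thesis using trace by simp
  qed
  have abs_nonneg: "0 \<le> (\<Sum>r\<in>#M. \<bar>r\<bar>)" for M :: "real multiset" by (induction M) auto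
  have "0 \<le> l" using abs_N abs_nonneg[of N] by simp
  then show "(\<Sum>x\<in>#proots (char_poly ?A). cmod x) = 2 * l"
    using abs_N by (simp add: roots image_mset.compositionality comp_def)
  have le: "\<bar>r\<bar> \<le> l" if "r \<in># N" for r
  proof -
    obtain M where "N = add_mset r M" using \<open>r \<in># N\<close> by (metis multi_member_split)
    then show ?thesis using abs_N abs_nonneg[of M] by simp
  qed
  have "char_poly ?A \<noteq> 0" using degree_monic_char_poly[of ?A n] A by fastforce
  then have "spectrum ?A = set_mset (proots (char_poly ?A))"
    using spectrum_root_char_poly[of ?A n] A by simp
  then have "cmod ` spectrum ?A = (\<lambda>r. \<bar>r\<bar>) ` set_mset ?R"
    unfolding roots by (simp add: image_image)
  then show "spectral_radius ?A = l"
    unfolding spectral_radius_def using le \<open>0 \<le> l\<close> by (auto intro!: Max_eqI)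
qed

section \<open>Spectra of the complete graph with and without an edge\<close>

lemma vdegree_complete:
  assumes "v < n" shows "vdegree (complete_edges n) v = n - 1"
proof -
  have "{e \<in> complete_edges n. v \<in> e} = (\<lambda>w. {v, w}) ` ({..<n} - {v})" (is "?L = ?R")
  proof
    show "?L \<subseteq> ?R" by (auto simp: complete_edges_def card_2_iff doubleton_eq_iff)
    show "?R \<subseteq> ?L" using assms by (auto simp: complete_edges_def)
  qed
  moreover have "inj_on (\<lambda>w. {v, w}) ({..<n} - {v})"
    by (auto simp: inj_on_def doubleton_eq_iff)
  ultimately show ?thesis using assms by (simp add: vdegree_def card_image)
qed

lemma vdegree_complete_delete:
  assumes "v < n" "e \<in> complete_edges n"
  shows "vdegree (complete_edges n - {e}) v = (if v \<in> e then n - 2 else n - 1)"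
proof -
  have "{d \<in> complete_edges n - {e}. v \<in> d} =
      (if v \<in> e then {d \<in> complete_edges n. v \<in> d} - {e} else {d \<in> complete_edges n. v \<in> d})"
    by auto
  moreover have "card ({d \<in> complete_edges n. v \<in> d} - {e}) = n - 1 - 1" if "v \<in> e"
    using that assms vdegree_complete[OF assms(1)]
    by (subst card_Diff_singleton) (simp_all add: vdegree_def)
  ultimately show ?thesis
    using vdegree_complete[OF assms(1)] by (simp add: vdegree_def numeral_2_eq_2)
qed

lemma doubleton_in_complete_edges:
  "i < n \<Longrightarrow> j < n \<Longrightarrow> {i, j} \<in> complete_edges n \<longleftrightarrow> i \<noteq> j"
  by (cases "i = j") (simp_all add: complete_edges_def)

lemma weighted_complete_spectrum:
  fixes \<phi> :: "real \<Rightarrow> real \<Rightarrow> real" and n :: nat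
  defines "b \<equiv> \<phi> (real n - 1) (real n - 1)"
  assumes "0 < n" "0 \<le> b"
  shows "weighted_spectral_radius \<phi> n (complete_edges n) = (real n - 1) * b"
    and "weighted_energy \<phi> n (complete_edges n) = 2 * ((real n - 1) * b)"
proof -
  let ?A = "weighted_adj_mat \<phi> n (complete_edges n)"
  have A: "?A = mat n n (\<lambda>(i, j). b - (if i = j then b else 0))"
    using \<open>0 < n\<close>
    by (intro eq_matI)
       (auto simp: weighted_adj_mat_def doubleton_in_complete_edges vdegree_complete b_def of_nat_diff)
  have "char_poly ?A = [:b, 1:] ^ (n - 1) * [:- ((real n - 1) * b), 1:]"
  proof (rule char_poly_equitable_quotient[where f = "\<lambda>_. 0" and C = "\<lambda>_ _. b"])
    fix x
    show "det (mat 1 1 (\<lambda>(k, l). (if k = l then x + b else 0)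
        - of_nat (card {i. i < n \<and> 0 = l}) * b)) = poly [:- ((real n - 1) * b), 1:] x"
      by (subst det_single) (auto simp: algebra_simps)
  qed (use A \<open>0 < n\<close> in auto)
  then have split: "char_poly ?A = (\<Prod>r\<in>#add_mset ((real n - 1) * b) (replicate_mset (n - 1) (- b)). [:- r, 1:])"
    by (simp add: mult.commute[of "_ ^ _"] del: mult_pCons_left mult_pCons_right)
  have "?A \<in> carrier_mat n n" by (simp add: weighted_adj_mat_def)
  moreover have "r \<le> 0" if "r \<in># replicate_mset (n - 1) (- b)" for r
    using that \<open>0 \<le> b\<close> by (auto simp: in_replicate_mset split: if_splits)
  moreover have "(real n - 1) * b = - \<Sum>\<^sub># (replicate_mset (n - 1) (- b))"
    using \<open>0 < n\<close> by (simp add: of_nat_diff)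
  ultimately show "weighted_spectral_radius \<phi> n (complete_edges n) = (real n - 1) * b"
    "weighted_energy \<phi> n (complete_edges n) = 2 * ((real n - 1) * b)"
    unfolding weighted_spectral_radius_def weighted_energy_def
    using one_positive_eigenvalue[OF _ split] by blast+
qed

text \<open>
  The factor \<open>x\<close> belongs to the vector that is \<open>1\<close> and \<open>- 1\<close> on the two singleton cells, and the
  quadratic factor to the vectors that agree on them.
\<close>

lemma quotient_complete_delete_det:
  fixes a b x N :: real and C :: "nat \<Rightarrow> nat \<Rightarrow> real" and c :: "nat \<Rightarrow> nat"
  assumes C: "C 0 0 = b" "C 0 1 = 0" "C 0 2 = a" "C 1 0 = 0" "C 1 1 = b" "C 1 2 = a"
    "C 2 0 = a" "C 2 1 = a" "C 2 2 = b"
    and c: "c 0 = 1" "c 1 = 1" "real (c 2) = N - 2"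
  shows "det (mat 3 3 (\<lambda>(k, l). (if k = l then x + b else 0) - real (c l) * C k l)) =
    x * (x ^ 2 - (N - 3) * b * x - 2 * (N - 2) * a ^ 2)"
proof -
  have "det (mat 3 3 (\<lambda>(k, l). (if k = l then x + b else 0) - real (c l) * C k l)) =
    x * (x * (x + b - (N - 2) * b) - (N - 2) * a * a) - a * (x * (N - 2) * a)"
    unfolding det_mat_3 prod.case C c by simp
  also have "\<dots> = x * (x ^ 2 - (N - 3) * b * x - 2 * (N - 2) * a ^ 2)"
    by (simp add: algebra_simps power2_eq_square)
  finally show ?thesis .
qed

text \<open>
  The two ends of the deleted edge are separate cells, since a common cell would put the same number
  on the diagonal, where \<open>b\<close> is needed, and between the two ends, where the entry is \<open>0\<close>. The
  hypotheses on \<open>l\<close> say that it is a root of the quadratic factor and that the other root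
  \<open>(n - 3) * b - l\<close> is not positive.
\<close>

lemma weighted_complete_delete_spectrum:
  fixes \<phi> :: "real \<Rightarrow> real \<Rightarrow> real" and n :: nat
  defines "b \<equiv> \<phi> (real n - 1) (real n - 1)"
    and "a \<equiv> \<phi> (real n - 2) (real n - 1)"
  assumes "3 \<le> n" "e \<in> complete_edges n"
    and sym: "\<phi> (real n - 1) (real n - 2) = a"
    and l: "l ^ 2 = (real n - 3) * b * l + 2 * (real n - 2) * a ^ 2"
    and "(real n - 3) * b \<le> l" "0 \<le> b"
  shows "weighted_spectral_radius \<phi> n (complete_edges n - {e}) = l"
    and "weighted_energy \<phi> n (complete_edges n - {e}) = 2 * l"
proof -
  let ?A = "weighted_adj_mat \<phi> n (complete_edges n - {e})"
  obtain u v where e: "e = {u, v}" "u \<noteq> v" "u < n" "v < n"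
    using assms(4) by (auto simp: complete_edges_def card_2_iff)
  define f :: "nat \<Rightarrow> nat" where "f i = (if i = u then 0 else if i = v then 1 else 2)" for i
  define C where "C k l = (if k = 2 \<and> l = 2 then b else if k = 2 \<or> l = 2 then a
    else if k = l then b else 0)" for k l :: nat
  have A: "?A = mat n n (\<lambda>(i, j). C (f i) (f j) - (if i = j then b else 0))"
  proof (rule eq_matI)
    fix i j assume "i < dim_row (mat n n (\<lambda>(i, j). C (f i) (f j) - (if i = j then b else 0)))"
      "j < dim_col (mat n n (\<lambda>(i, j). C (f i) (f j) - (if i = j then b else 0)))"
    then have ij: "i < n" "j < n" by auto
    have deg: "real (vdegree (complete_edges n - {e}) k) = (if k = u \<or> k = v then real n - 2 else real n - 1)"
      if "k < n" for k
      using vdegree_complete_delete[OF that assms(4)] \<open>3 \<le> n\<close> e by (auto simp: of_nat_diff)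
    have edge: "{i, j} \<in> complete_edges n - {e} \<longleftrightarrow>
        i \<noteq> j \<and> \<not> (i = u \<and> j = v) \<and> \<not> (i = v \<and> j = u)"
      using ij by (auto simp: doubleton_in_complete_edges e(1) doubleton_eq_iff)
    have "?A $$ (i, j) = C (f i) (f j) - (if i = j then b else 0)"
      using ij sym e(2)
      unfolding weighted_adj_mat_def index_mat(1)[OF ij] prod.case edge deg[OF ij(1)] deg[OF ij(2)]
      by (simp add: C_def f_def a_def b_def)
    then show "?A $$ (i, j) = mat n n (\<lambda>(i, j). C (f i) (f j) - (if i = j then b else 0)) $$ (i, j)"
      using ij by simp
  qed (auto simp: weighted_adj_mat_def)
  have card: "{i. i < n \<and> f i = 0} = {u}" "{i. i < n \<and> f i = 1} = {v}"
    "{i. i < n \<and> f i = 2} = {..<n} - {u, v}"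
    using e by (auto simp: f_def)
  have card2: "card ({..<n} - {u, v}) = n - 2"
    using e by (subst card_Diff_subset) auto
  have C: "C 0 0 = b" "C 0 1 = 0" "C 0 2 = a" "C 1 0 = 0" "C 1 1 = b" "C 1 2 = a"
    "C 2 0 = a" "C 2 1 = a" "C 2 2 = b"
    by (simp_all add: C_def)
  have c: "card {i. i < n \<and> f i = 0} = 1" "card {i. i < n \<and> f i = 1} = 1"
    "real (card {i. i < n \<and> f i = 2}) = real n - 2"
    unfolding card card2 using \<open>3 \<le> n\<close> by (simp_all add: of_nat_diff)
  define q where "q = [:0, 1:] * [:- l, 1:] * [:l - (real n - 3) * b, 1:]"
  have q: "poly q x = x * (x ^ 2 - (real n - 3) * b * x - 2 * (real n - 2) * a ^ 2)" for x
  proof -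
    have "poly q x = x * (x ^ 2 - (real n - 3) * b * x - (l ^ 2 - (real n - 3) * b * l))"
      by (simp add: q_def algebra_simps power2_eq_square)
    then show ?thesis using l by simp
  qed
  have "char_poly ?A = [:b, 1:] ^ (n - 3) * q"
  proof (rule char_poly_equitable_quotient[where f = f and C = C])
    fix x
    show "det (mat 3 3 (\<lambda>(k, l). (if k = l then x + b else 0)
        - of_nat (card {i. i < n \<and> f i = l}) * C k l)) = poly q x"
      unfolding q by (intro quotient_complete_delete_det C c)
  qed (use A \<open>3 \<le> n\<close> in \<open>auto simp: f_def\<close>)
  define N where "N = add_mset 0 (add_mset ((real n - 3) * b - l) (replicate_mset (n - 3) (- b)))"
  with \<open>char_poly ?A = _\<close> have split: "char_poly ?A = (\<Prod>r\<in>#add_mset l N. [:- r, 1:])"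
    by (simp add: q_def mult_ac del: mult_pCons_left mult_pCons_right)
  have "?A \<in> carrier_mat n n" by (simp add: weighted_adj_mat_def)
  moreover have "r \<le> 0" if "r \<in># N" for r
    using that assms(7,8) by (auto simp: N_def in_replicate_mset split: if_splits)
  moreover have "l = - \<Sum>\<^sub># N"
    using \<open>3 \<le> n\<close> by (simp add: N_def of_nat_diff)
  ultimately show "weighted_spectral_radius \<phi> n (complete_edges n - {e}) = l"
    "weighted_energy \<phi> n (complete_edges n - {e}) = 2 * l"
    unfolding weighted_spectral_radius_def weighted_energy_def
    using one_positive_eigenvalue[OF _ split] by blast+
qed

section \<open>Comparison of the spectral radii\<close>

lemma positive_root_vs_complete:
  fixes N a b l :: real
  defines "t \<equiv> (N - 3) * b" and "p \<equiv> 2 * (N - 2) * a ^ 2"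
  assumes N: "3 \<le> N" and a: "0 < a" and b: "0 < b" and l: "l ^ 2 = t * l + p" and "t < l"
  shows "b / a < sqrt ((N - 2) / (N - 1)) \<longleftrightarrow> (N - 1) * b < l"
    and "sqrt ((N - 2) / (N - 1)) < b / a \<longleftrightarrow> l < (N - 1) * b"
proof -
  define D where "D = (N - 1) * b ^ 2 - (N - 2) * a ^ 2"
  \<comment> \<open>The roots of \<open>x\<^sup>2 - t * x - p\<close> are \<open>l\<close> and \<open>t - l\<close>, and \<open>t - l\<close> is negative, so the sign of the
    quadratic at \<open>(N - 1) * b\<close> is the sign of \<open>(N - 1) * b - l\<close>.\<close>
  define P where "P = (N - 1) * b + (l - t)"
  have 1: "0 < (N - 1) * b" using N b by simp
  have pos: "0 < P" using 1 \<open>t < l\<close> by (simp add: P_def)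
  have prod: "((N - 1) * b - l) * P = 2 * D"
  proof -
    have t: "t = (N - 1) * b - 2 * b" by (simp add: t_def algebra_simps)
    have "((N - 1) * b - l) * P = ((N - 1) * b) * (2 * b) - (l ^ 2 - t * l)"
      by (simp add: P_def t algebra_simps power2_eq_square)
    also have "\<dots> = 2 * D"
      using l by (simp add: p_def D_def algebra_simps power2_eq_square)
    finally show ?thesis .
  qed
  have sqrt: "b / a = sqrt (b ^ 2 / a ^ 2)" using a b by (simp add: real_sqrt_divide)
  have "b / a < sqrt ((N - 2) / (N - 1)) \<longleftrightarrow> D < 0"
    using N a unfolding sqrt real_sqrt_less_iff D_def
    by (simp add: divide_less_eq less_divide_eq mult.commute)
  also have "\<dots> \<longleftrightarrow> ((N - 1) * b - l) * P < 0" by (simp only: prod) simp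
  also have "\<dots> \<longleftrightarrow> (N - 1) * b < l" using pos by (simp add: mult_less_0_iff)
  finally show "b / a < sqrt ((N - 2) / (N - 1)) \<longleftrightarrow> (N - 1) * b < l" .
  have "sqrt ((N - 2) / (N - 1)) < b / a \<longleftrightarrow> 0 < D"
    using N a unfolding sqrt real_sqrt_less_iff D_def
    by (simp add: divide_less_eq less_divide_eq mult.commute)
  also have "\<dots> \<longleftrightarrow> 0 < ((N - 1) * b - l) * P" by (simp only: prod) simp
  also have "\<dots> \<longleftrightarrow> l < (N - 1) * b" using pos by (simp add: zero_less_mult_iff)
  finally show "sqrt ((N - 2) / (N - 1)) < b / a \<longleftrightarrow> l < (N - 1) * b" .
qed

theorem theorem3p2:
  fixes n :: nat and e :: "nat set" and \<phi> :: "real \<Rightarrow> real \<Rightarrow> real"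
    and a b R \<tau> :: real and K Ke :: "nat set set"
  defines "K \<equiv> complete_edges n"
    and "Ke \<equiv> complete_edges n - {e}"
    and "b \<equiv> \<phi> (real n - 1) (real n - 1)"
    and "a \<equiv> \<phi> (real n - 2) (real n - 1)"
    and "R \<equiv> b / a"
    and "\<tau> \<equiv> sqrt ((real n - 2) / (real n - 1))"
  assumes "n \<ge> 3"
    and "e \<in> K"
    and "symmetric_weight \<phi>"
    and "positive_on_edges \<phi> K"
    and "positive_on_edges \<phi> Ke"
  shows "weighted_energy \<phi> n Ke - weighted_energy \<phi> n K =
           2 * (weighted_spectral_radius \<phi> n Ke - weighted_spectral_radius \<phi> n K) \<and>
         (R < \<tau> \<longrightarrow> weighted_spectral_radius \<phi> n Ke > weighted_spectral_radius \<phi> n K \<and>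
                   weighted_energy \<phi> n Ke > weighted_energy \<phi> n K) \<and>
         (R = \<tau> \<longrightarrow> weighted_spectral_radius \<phi> n Ke = weighted_spectral_radius \<phi> n K \<and>
                   weighted_energy \<phi> n Ke = weighted_energy \<phi> n K) \<and>
         (R > \<tau> \<longrightarrow> weighted_spectral_radius \<phi> n Ke < weighted_spectral_radius \<phi> n K \<and>
                   weighted_energy \<phi> n Ke < weighted_energy \<phi> n K)"
proof -
  have n: "3 \<le> n" by fact
  have eK: "e \<in> complete_edges n" using \<open>e \<in> K\<close> by (simp add: K_def)
  have card_e: "card e = 2" "e \<subseteq> {..<n}" using eK by (auto simp: complete_edges_def)
  then obtain u v where e: "e = {u, v}" "u \<noteq> v" "u < n" "v < n" by (auto simp: card_2_iff)
  \<comment> \<open>A third vertex is adjacent to \<open>u\<close> after the deletion, which makes \<open>a\<close> positive.\<close>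
  have "\<not> {..<n} \<subseteq> e"
    using card_mono[of e "{..<n}"] card_e n by (auto simp: card_ge_0_finite)
  then obtain w where w: "w < n" "w \<notin> e" by auto
  have edges: "{u, v} \<in> complete_edges n" "{u, w} \<in> complete_edges n - {e}"
    using e w by (auto simp: doubleton_in_complete_edges doubleton_eq_iff)
  have "0 < \<phi> (real (vdegree K u)) (real (vdegree K v))"
    using assms(10) edges(1) unfolding positive_on_edges_def K_def by blast
  then have b: "0 < b"
    using e(3,4) n by (simp add: K_def b_def vdegree_complete of_nat_diff)
  have "0 < \<phi> (real (vdegree Ke u)) (real (vdegree Ke w))"
    using assms(11) edges(2) unfolding positive_on_edges_def Ke_def by blast
  moreover have "vdegree Ke u = n - 2" "vdegree Ke w = n - 1"
    using vdegree_complete_delete[OF e(3) eK] vdegree_complete_delete[OF w(1) eK] e(1) w(2)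
    unfolding Ke_def by simp_all
  ultimately have a: "0 < a"
    using n by (simp add: a_def of_nat_diff)
  have sym: "\<phi> (real n - 1) (real n - 2) = a"
    using assms(9) n unfolding symmetric_weight_def a_def by simp

  \<comment> \<open>\<open>l\<close> is the positive root of \<open>x\<^sup>2 - t * x - p\<close>.\<close>
  define t where "t = (real n - 3) * b"
  define p where "p = 2 * (real n - 2) * a ^ 2"
  define s where "s = sqrt (t ^ 2 + 4 * p)"
  define l where "l = (t + s) / 2"
  have "0 < p" using n a by (simp add: p_def)
  have s: "s ^ 2 = t ^ 2 + 4 * p" using \<open>0 < p\<close> by (simp add: s_def)
  have "t < s"
    unfolding s_def by (rule real_less_rsqrt) (use \<open>0 < p\<close> in simp)
  have l: "l ^ 2 = t * l + p"
    using s by (simp add: l_def field_simps power2_eq_square)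
  have "t < l" using \<open>t < s\<close> by (simp add: l_def)

  have K: "weighted_spectral_radius \<phi> n K = (real n - 1) * b"
    "weighted_energy \<phi> n K = 2 * ((real n - 1) * b)"
    unfolding K_def b_def using b n by (intro weighted_complete_spectrum; simp add: b_def)+
  have Ke: "weighted_spectral_radius \<phi> n Ke = l" "weighted_energy \<phi> n Ke = 2 * l"
    unfolding Ke_def
    using weighted_complete_delete_spectrum[OF n eK, of \<phi> l, folded a_def b_def, folded t_def, folded p_def]
      sym l \<open>t < l\<close> b by simp_all
  have "R < \<tau> \<longleftrightarrow> (real n - 1) * b < l" "\<tau> < R \<longleftrightarrow> l < (real n - 1) * b"
    unfolding R_def \<tau>_def
    using positive_root_vs_complete[of "real n" a b l, folded t_def, folded p_def] n a b l \<open>t < l\<close>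
    by simp_all
  then show ?thesis unfolding K Ke by auto
qed

end
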